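(* Let $\rho$ be a (finitary) relation on a finite set $A$. If $A$ has a nonempty subset $B$ such that for the clone on $B$ determined by the restriction $\rho|_B$ of $\rho$ to $B$ we have $\mathrm{Pol}\,\rho|_B\notin\mathfrak{F}_B$, then $\mathrm{Pol}\,\rho\notin\mathfrak{F}_A$.
   Context: For a finite nonempty set $X$ and $n\ge 1$, an $n$-ary operation on $X$ is a function $X^n\to X$; $\mathcal{O}_X$ is the set of all finitary operations on $X$, and $\mathcal{C}^{(n)}$ is the set of $n$-ary members of $\mathcal{C}\subseteq\mathcal{O}_X$. A clone on $X$ is a set $\mathcal{C}\subseteq\mathcal{O}_X$ containing all projections and closed under composition. For a clone $\mathcal{C}$ on $X$, an $n$-ary $f$ and an $m$-ary $g$ in $\mathcal{O}_X$, write $f\leq_{\mathcal{C}} g$ if $f=g(h_1,\dots,h_m)$ for some $h_1,\dots,h_m\in\mathcal{C}^{(n)}$, and $f\equiv_{\mathcal{C}}g$ if $f\leq_{\mathcal{C}}g$ and $g\leq_{\mathcal{C}}f$. $\mathfrak{F}_X$ denotes the set of all clones $\mathcal{C}$ on $X$ such that the equivalence relation $\equiv_{\mathcal{C}}$ on $\mathcal{O}_X$ has only finitely many classes. For a relation $\rho\subseteq X^r$, $\mathrm{Pol}\,\rho$ is the clone on $X$ of all operations preserving $\rho$, i.e. operations which applied coordinatewise to tuples of $\rho$ give tuples of $\rho$. For $\rho\subseteq A^r$ and $B\subseteq A$, $\rho|_B=\rho\cap B^r$, and $\mathrm{Pol}\,\rho|_B$ is the clone on $B$ of all operations on $B$ preserving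 $\rho|_B$. *)

theory Defs
  imports "HOL-Library.FuncSet"
begin

definition tuples :: "'a set \<Rightarrow> nat \<Rightarrow> 'a list set" where
  "tuples X n = {xs. length xs = n \<and> set xs \<subseteq> X}"

text \<open>An operation is a pair of its arity \<open>n\<close> and a function on \<open>n\<close>-tuples. The arity is part of the
  data, and the function is extensional (equal to \<open>undefined\<close> off \<open>X^n\<close>), so that equality of
  operations on \<open>X\<close> is equality of HOL terms.\<close>

type_synonym 'a operation = "nat \<times> ('a list \<Rightarrow> 'a)"

abbreviation arity :: "'a operation \<Rightarrow> nat" where
  "arity f \<equiv> fst f"

abbreviation app :: "'a operation \<Rightarrow> 'a list \<Rightarrow> 'a" where
  "app f \<equiv> snd f"

definition operations :: "'a set \<Rightarrow> 'a operation set" where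
  "operations X = {f. arity f \<ge> 1 \<and> app f \<in> tuples X (arity f) \<rightarrow>\<^sub>E X}"

definition nary :: "'a operation set \<Rightarrow> nat \<Rightarrow> 'a operation set" where
  "nary C n = {f \<in> C. arity f = n}"

definition projection :: "'a set \<Rightarrow> nat \<Rightarrow> nat \<Rightarrow> 'a operation" where
  "projection X n i = (n, \<lambda>xs\<in>tuples X n. xs ! i)"

text \<open>\<open>superpose X n g [h\<^sub>1, \<dots>, h\<^sub>m]\<close> is the \<open>n\<close>-ary operation \<open>g(h\<^sub>1, \<dots>, h\<^sub>m)\<close> on \<open>X\<close>; it is meant for
  \<open>m\<close>-ary \<open>g\<close> and \<open>n\<close>-ary \<open>h\<^sub>1, \<dots>, h\<^sub>m\<close>.\<close>

definition superpose :: "'a set \<Rightarrow> nat \<Rightarrow> 'a operation \<Rightarrow> 'a operation list \<Rightarrow> 'a operation" where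
  "superpose X n g hs = (n, \<lambda>xs\<in>tuples X n. app g (map (\<lambda>h. app h xs) hs))"

definition clone :: "'a set \<Rightarrow> 'a operation set \<Rightarrow> bool" where
  "clone X C \<longleftrightarrow>
     C \<subseteq> operations X \<and>
     (\<forall>n i. i < n \<longrightarrow> projection X n i \<in> C) \<and>
     (\<forall>n g hs. g \<in> C \<and> length hs = arity g \<and> set hs \<subseteq> nary C n \<longrightarrow> superpose X n g hs \<in> C)"

definition minor_le :: "'a set \<Rightarrow> 'a operation set \<Rightarrow> 'a operation \<Rightarrow> 'a operation \<Rightarrow> bool" where
  "minor_le X C f g \<longleftrightarrow>
     (\<exists>hs. length hs = arity g \<and> set hs \<subseteq> nary C (arity f) \<and> f = superpose X (arity f) g hs)"

definition minor_equiv :: "'a set \<Rightarrow> 'a operation set \<Rightarrow> 'a operation rel" where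
  "minor_equiv X C =
     {(f, g). f \<in> operations X \<and> g \<in> operations X \<and> minor_le X C f g \<and> minor_le X C g f}"

definition FF :: "'a set \<Rightarrow> 'a operation set set" where
  "FF X = {C. clone X C \<and> finite (operations X // minor_equiv X C)}"

text \<open>For an \<open>n\<close>-ary operation \<open>f\<close> and \<open>r\<close>-tuples \<open>t\<^sub>1, \<dots>, t\<^sub>n\<close> of \<open>\<rho>\<close>, the \<open>i\<close>-th coordinate of the
  resulting \<open>r\<close>-tuple is \<open>f\<close> applied to the \<open>i\<close>-th coordinates of \<open>t\<^sub>1, \<dots>, t\<^sub>n\<close>.\<close>

definition preserves :: "nat \<Rightarrow> 'a operation \<Rightarrow> 'a list set \<Rightarrow> bool" where
  "preserves r f \<rho> \<longleftrightarrow>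
     (\<forall>ts. length ts = arity f \<and> set ts \<subseteq> \<rho> \<longrightarrow>
        map (\<lambda>i. app f (map (\<lambda>t. t ! i) ts)) [0..<r] \<in> \<rho>)"

definition Pol :: "'a set \<Rightarrow> nat \<Rightarrow> 'a list set \<Rightarrow> 'a operation set" where
  "Pol X r \<rho> = {f \<in> operations X. preserves r f \<rho>}"

text \<open>The following two facts show that \<open>Pol X r \<rho>\<close> is always a clone, so that \<open>Pol X r \<rho> \<notin> FF X\<close> says
  exactly that there are infinitely many classes, and that these are classes of an equivalence
  relation.\<close>

lemma superpose_operations:
  assumes "g \<in> operations X" "length hs = arity g" "set hs \<subseteq> nary (operations X) n"
  shows "superpose X n g hs \<in> operations X"
proof -
  have "hs \<noteq> []" using assms by (auto simp: operations_def)
  then have "hd hs \<in> nary (operations X) n" using assms(3) hd_in_set by blast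
  then have n: "n \<ge> 1" by (auto simp: nary_def operations_def)
  have "app g (map (\<lambda>h. app h xs) hs) \<in> X" if "xs \<in> tuples X n" for xs
  proof -
    have "app h xs \<in> X" if "h \<in> set hs" for h
      using assms(3) that \<open>xs \<in> tuples X n\<close> by (auto simp: nary_def operations_def)
    then have "map (\<lambda>h. app h xs) hs \<in> tuples X (arity g)"
      using assms(2) by (auto simp: tuples_def)
    then show ?thesis using assms(1) by (auto simp: operations_def)
  qed
  then show ?thesis using n by (auto simp: superpose_def operations_def)
qed

lemma clone_Pol:
  assumes \<rho>: "\<rho> \<subseteq> tuples X r"
  shows "clone X (Pol X r \<rho>)"
  unfolding clone_def
proof (intro conjI allI impI)
  show "Pol X r \<rho> \<subseteq> operations X" by (auto simp: Pol_def)
next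
  fix n i :: nat assume i: "i < n"
  have "preserves r (projection X n i) \<rho>"
    unfolding preserves_def
  proof (intro allI impI)
    fix ts assume ts: "length ts = arity (projection X n i) \<and> set ts \<subseteq> \<rho>"
    then have len: "length ts = n" by (simp add: projection_def)
    have in_X: "map (\<lambda>t. t ! j) ts \<in> tuples X n" if "j < r" for j
      using ts \<rho> len that by (fastforce simp: tuples_def)
    have ti: "ts ! i \<in> \<rho>" using ts len i by auto
    have "map (\<lambda>j. app (projection X n i) (map (\<lambda>t. t ! j) ts)) [0..<r]
        = map (\<lambda>j. (ts ! i) ! j) [0..<r]"
      using in_X len i by (auto simp: projection_def)
    also have "\<dots> = ts ! i"
      using ti \<rho> by (auto simp: tuples_def intro!: nth_equalityI)
    finally show "map (\<lambda>j. app (projection X n i) (map (\<lambda>t. t ! j) ts)) [0..<r] \<in> \<rho>"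
      using ti by simp
  qed
  moreover have "projection X n i \<in> operations X"
    using i by (auto simp: projection_def operations_def tuples_def)
  ultimately show "projection X n i \<in> Pol X r \<rho>" by (simp add: Pol_def)
next
  fix n g and hs :: "'a operation list"
  assume H: "g \<in> Pol X r \<rho> \<and> length hs = arity g \<and> set hs \<subseteq> nary (Pol X r \<rho>) n"
  have "preserves r (superpose X n g hs) \<rho>"
    unfolding preserves_def
  proof (intro allI impI)
    fix ts assume ts: "length ts = arity (superpose X n g hs) \<and> set ts \<subseteq> \<rho>"
    then have len: "length ts = n" by (simp add: superpose_def)
    have in_X: "map (\<lambda>t. t ! j) ts \<in> tuples X n" if "j < r" for j
      using ts \<rho> len that by (fastforce simp: tuples_def)
    define us where "us = map (\<lambda>h. map (\<lambda>j. app h (map (\<lambda>t. t ! j) ts)) [0..<r]) hs"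
    have "set us \<subseteq> \<rho>"
      using H ts len by (auto simp: us_def nary_def Pol_def preserves_def)
    moreover have "length us = arity g" using H by (simp add: us_def)
    ultimately have "map (\<lambda>j. app g (map (\<lambda>u. u ! j) us)) [0..<r] \<in> \<rho>"
      using H by (auto simp: Pol_def preserves_def)
    moreover have "map (\<lambda>j. app (superpose X n g hs) (map (\<lambda>t. t ! j) ts)) [0..<r]
        = map (\<lambda>j. app g (map (\<lambda>u. u ! j) us)) [0..<r]"
      using in_X by (auto simp: superpose_def us_def comp_def)
    ultimately show "map (\<lambda>j. app (superpose X n g hs) (map (\<lambda>t. t ! j) ts)) [0..<r] \<in> \<rho>"
      by (simp only:)
  qed
  moreover have "superpose X n g hs \<in> operations X"
    using H by (intro superpose_operations) (auto simp: Pol_def nary_def)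
  ultimately show "superpose X n g hs \<in> Pol X r \<rho>" by (simp add: Pol_def)
qed

lemma minor_le_refl:
  assumes C: "clone X C" and f: "f \<in> operations X"
  shows "minor_le X C f f"
proof -
  define n where "n = arity f"
  define hs where "hs = map (projection X n) [0..<n]"
  have f': "app f \<in> tuples X n \<rightarrow>\<^sub>E X" using f by (simp add: operations_def n_def)
  have args: "map (\<lambda>h. app h xs) hs = xs" if "xs \<in> tuples X n" for xs
    using that by (auto simp: hs_def projection_def tuples_def intro!: nth_equalityI)
  have "app f = (\<lambda>xs\<in>tuples X n. app f (map (\<lambda>h. app h xs) hs))"
    using f' args by (auto simp: fun_eq_iff restrict_def PiE_def extensional_def)
  then have "f = superpose X n f hs"
    by (simp add: superpose_def n_def prod_eq_iff)
  moreover have "set hs \<subseteq> nary C n"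
    using C by (auto simp: hs_def nary_def clone_def projection_def)
  ultimately show ?thesis
    unfolding minor_le_def by (intro exI[of _ hs]) (simp add: hs_def n_def)
qed

lemma minor_le_trans:
  assumes C: "clone X C" and fg: "minor_le X C f g" and gk: "minor_le X C g k"
  shows "minor_le X C f k"
proof -
  obtain hs where hs: "length hs = arity g" "set hs \<subseteq> nary C (arity f)"
      "f = superpose X (arity f) g hs"
    using fg by (auto simp: minor_le_def)
  obtain ps where ps: "length ps = arity k" "set ps \<subseteq> nary C (arity g)"
      "g = superpose X (arity g) k ps"
    using gk by (auto simp: minor_le_def)
  define qs where "qs = map (\<lambda>p. superpose X (arity f) p hs) ps"
  have "superpose X (arity f) p hs \<in> nary C (arity f)" if "p \<in> set ps" for p
  proof -
    have "p \<in> C" "arity p = arity g" using that ps(2) by (auto simp: nary_def)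
    then have "superpose X (arity f) p hs \<in> C"
      using C hs(1,2) unfolding clone_def by metis
    then show ?thesis by (simp add: nary_def superpose_def)
  qed
  then have "set qs \<subseteq> nary C (arity f)" by (auto simp: qs_def)
  moreover have "superpose X (arity f) g hs = superpose X (arity f) k qs"
  proof -
    have "app g (map (\<lambda>h. app h xs) hs) = app k (map (\<lambda>q. app q xs) qs)"
      if xs: "xs \<in> tuples X (arity f)" for xs
    proof -
      have "app h xs \<in> X" if "h \<in> set hs" for h
      proof -
        have "h \<in> operations X" "arity h = arity f"
          using C that hs(2) by (auto simp: clone_def nary_def)
        then show ?thesis using xs by (auto simp: operations_def)
      qed
      then have "map (\<lambda>h. app h xs) hs \<in> tuples X (arity g)"
        using hs(1) by (auto simp: tuples_def)
      then have "app g (map (\<lambda>h. app h xs) hs)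
          = app k (map (\<lambda>p. app p (map (\<lambda>h. app h xs) hs)) ps)"
        by (subst ps(3)) (simp add: superpose_def)
      also have "\<dots> = app k (map (\<lambda>q. app q xs) qs)"
        using xs by (simp add: qs_def superpose_def comp_def)
      finally show ?thesis .
    qed
    then show ?thesis by (auto simp: superpose_def restrict_def)
  qed
  ultimately show ?thesis
    unfolding minor_le_def using hs(3) ps(1) by (intro exI[of _ qs]) (simp add: qs_def)
qed

lemma equiv_minor_equiv:
  assumes "clone X C"
  shows "equiv (operations X) (minor_equiv X C)"
proof (rule equivI)
  show "minor_equiv X C \<subseteq> operations X \<times> operations X" by (auto simp: minor_equiv_def)
  show "refl_on (operations X) (minor_equiv X C)"
    using minor_le_refl[OF assms] by (auto simp: refl_on_def minor_equiv_def)
  show "sym (minor_equiv X C)" by (auto simp: sym_def minor_equiv_def)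
  show "trans (minor_equiv X C)"
    using minor_le_trans[OF assms] unfolding trans_def minor_equiv_def by blast
qed

end

(* If B is a proper subset, fix c in A - B and extend each operation f on B to A by the constant
   value c outside of B^n. If f' = g'(h_1, ..., h_m) for such extensions, then on B^n the left-hand
   side lies in B, so each h_i must map B^n into B. Hence the h_i restrict to members of the clone
   on B, and f = g(h_1|B, ..., h_m|B). Thus inequivalent operations have inequivalent extensions. *)

theory Submission
  imports Defs
begin

text \<open>By \<open>reflect\<close>, elements of \<open>X\<close> whose images lie in one
  \<open>S\<close>-class are \<open>R\<close>-related. So the preimage of an \<open>S\<close>-class
  meets at most one \<open>R\<close>-class, and \<open>X\<close> has no more classes than
  \<open>Y\<close>.\<close>

lemma finite_quotient_reflect:
  assumes "equiv X R" "equiv Y S" "finite (Y // S)"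
    and f: "f \<in> X \<rightarrow> Y"
    and reflect: "\<And>x y. \<lbrakk>x \<in> X; y \<in> X; (f x, f y) \<in> S\<rbrakk> \<Longrightarrow> (x, y) \<in> R"
  shows "finite (X // R)"
proof (rule finite_surj[OF assms(3)])
  \<comment> \<open>Since \<open>f\<close> may send \<open>R\<close>-related elements to different
    \<open>S\<close>-classes, it induces no map \<open>X // R\<close> to \<open>Y // S\<close>; the
    covering map goes backwards. A preimage may be only part of an \<open>R\<close>-class, so it is
    saturated under \<open>R\<close>.\<close>
  show "X // R \<subseteq> (\<lambda>K. R `` (f -` K \<inter> X)) ` (Y // S)"
  proof
    fix K assume "K \<in> X // R"
    then obtain x where x: "x \<in> X" "K = R `` {x}" by (auto elim: quotientE)
    have "(f x, f x) \<in> S"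
      using x f assms(2) by (auto simp: equiv_def refl_on_def)
    moreover have "R `` {y} = R `` {x}" if "y \<in> f -` (S `` {f x}) \<inter> X" for y
      using that x(1) reflect equiv_class_eq[OF assms(1)] by blast
    ultimately have "R `` {x} = R `` (f -` (S `` {f x}) \<inter> X)"
      using x(1) by blast
    moreover have "S `` {f x} \<in> Y // S"
      using x f by (auto intro: quotientI)
    ultimately show "K \<in> (\<lambda>K. R `` (f -` K \<inter> X)) ` (Y // S)"
      using x by blast
  qed
qed

definition extend_op :: "'a set \<Rightarrow> 'a set \<Rightarrow> 'a \<Rightarrow> 'a operation \<Rightarrow> 'a operation" where
  "extend_op A B c f =
     (arity f, \<lambda>xs\<in>tuples A (arity f). if xs \<in> tuples B (arity f) then app f xs else c)"

definition restrict_op :: "'a set \<Rightarrow> 'a operation \<Rightarrow> 'a operation" where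
  "restrict_op B h = (arity h, restrict (app h) (tuples B (arity h)))"

lemma arity_extend_op [simp]: "arity (extend_op A B c f) = arity f"
  by (simp add: extend_op_def)

lemma arity_restrict_op [simp]: "arity (restrict_op B h) = arity h"
  by (simp add: restrict_op_def)

lemma tuples_mono: "B \<subseteq> A \<Longrightarrow> tuples B n \<subseteq> tuples A n"
  by (auto simp: tuples_def)

lemma extend_op_operations:
  assumes "f \<in> operations B" "B \<subseteq> A" "c \<in> A"
  shows "extend_op A B c f \<in> operations A"
  using assms by (fastforce simp: extend_op_def operations_def)

text \<open>Columns taken from \<rho> within \<open>tuples B r\<close> are sent into \<rho> because
  \<open>h\<close> preserves \<rho>, and into \<open>tuples B r\<close> because \<open>h\<close>
  keeps \<open>B\<close> closed, by \<open>maps\<close>.\<close>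

lemma restrict_op_Pol:
  assumes h: "h \<in> Pol A r \<rho>"
    and maps: "app h \<in> tuples B (arity h) \<rightarrow> B"
  shows "restrict_op B h \<in> Pol B r (\<rho> \<inter> tuples B r)"
proof -
  have "preserves r (restrict_op B h) (\<rho> \<inter> tuples B r)"
    unfolding preserves_def
  proof (intro allI impI)
    fix ts assume ts: "length ts = arity (restrict_op B h) \<and> set ts \<subseteq> \<rho> \<inter> tuples B r"
    have in_B: "map (\<lambda>t. t ! i) ts \<in> tuples B (arity h)" if "i < r" for i
      using ts that by (fastforce simp: tuples_def)
    have "map (\<lambda>i. app (restrict_op B h) (map (\<lambda>t. t ! i) ts)) [0..<r]
        = map (\<lambda>i. app h (map (\<lambda>t. t ! i) ts)) [0..<r]"
      using in_B by (simp add: restrict_op_def)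
    moreover have "\<dots> \<in> \<rho>"
      using h ts by (auto simp: Pol_def preserves_def)
    moreover have "map (\<lambda>i. app h (map (\<lambda>t. t ! i) ts)) [0..<r] \<in> tuples B r"
      using in_B maps by (auto simp: tuples_def[of B r])
    ultimately show "map (\<lambda>i. app (restrict_op B h) (map (\<lambda>t. t ! i) ts)) [0..<r]
        \<in> \<rho> \<inter> tuples B r"
      by (simp only: Int_iff)
  qed
  moreover have "restrict_op B h \<in> operations B"
    using h maps by (auto simp: Pol_def operations_def restrict_op_def)
  ultimately show ?thesis by (simp add: Pol_def)
qed

text \<open>This is the reflection property required by \<open>finite_quotient_reflect\<close>,
  stated for one direction of the equivalence.\<close>

lemma minor_le_extend_opD:
  assumes "B \<subseteq> A" "c \<notin> B" "f \<in> operations B" "g \<in> operations B"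
    and le: "minor_le A (Pol A r \<rho>) (extend_op A B c f) (extend_op A B c g)"
  shows "minor_le B (Pol B r (\<rho> \<inter> tuples B r)) f g"
proof -
  define n where "n = arity f"
  obtain hs where hs: "length hs = arity g" "set hs \<subseteq> nary (Pol A r \<rho>) n"
    and eq: "extend_op A B c f = superpose A n (extend_op A B c g) hs"
    using le by (auto simp: minor_le_def n_def)
  have main: "map (\<lambda>h. app h xs) hs \<in> tuples B (arity g)
      \<and> app f xs = app g (map (\<lambda>h. app h xs) hs)" if xs: "xs \<in> tuples B n" for xs
  proof -
    let ?ys = "map (\<lambda>h. app h xs) hs"
    have xsA: "xs \<in> tuples A n" using xs tuples_mono[OF assms(1)] by blast
    have "app h xs \<in> A" if "h \<in> set hs" for h
      using that hs(2) xsA by (auto simp: nary_def Pol_def operations_def)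
    then have ysA: "?ys \<in> tuples A (arity g)"
      using hs(1) by (auto simp: tuples_def)
    have "app f xs = app (extend_op A B c f) xs"
      using xs xsA by (simp add: extend_op_def n_def)
    also have "\<dots> = app (extend_op A B c g) ?ys"
      unfolding eq using xsA by (simp add: superpose_def)
    also have "\<dots> = (if ?ys \<in> tuples B (arity g) then app g ?ys else c)"
      using ysA by (simp add: extend_op_def)
    finally have "app f xs = (if ?ys \<in> tuples B (arity g) then app g ?ys else c)" .
    \<comment> \<open>As \<open>c\<close> lies outside \<open>B\<close>, this value excludes the
      default branch, which yields both halves of \<open>main\<close> at once.\<close>
    moreover have "app f xs \<in> B"
      using assms(3) xs by (auto simp: operations_def n_def)
    ultimately show ?thesis using assms(2) by (auto split: if_splits)
  qed
  have "restrict_op B h \<in> nary (Pol B r (\<rho> \<inter> tuples B r)) n" if h: "h \<in> set hs" for h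
  proof -
    have "h \<in> Pol A r \<rho>" "arity h = n" using h hs(2) by (auto simp: nary_def)
    \<comment> \<open>A tuple lies in \<open>tuples B (arity g)\<close> only if all its entries lie
      in \<open>B\<close>, so \<open>main\<close> controls each \<open>h\<close> separately.\<close>
    moreover have "app h \<in> tuples B n \<rightarrow> B"
    proof
      fix xs assume "xs \<in> tuples B n"
      then have "set (map (\<lambda>h. app h xs) hs) \<subseteq> B"
        using main by (simp add: tuples_def[of B "arity g"])
      then show "app h xs \<in> B" using h by auto
    qed
    ultimately show ?thesis using restrict_op_Pol[of h A r \<rho> B] by (simp add: nary_def)
  qed
  then have "set (map (restrict_op B) hs) \<subseteq> nary (Pol B r (\<rho> \<inter> tuples B r)) n"
    by auto
  moreover have "length (map (restrict_op B) hs) = arity g"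
    using hs(1) by simp
  moreover have "f = superpose B n g (map (restrict_op B) hs)"
  proof -
    have args: "map (\<lambda>h. app h xs) (map (restrict_op B) hs) = map (\<lambda>h. app h xs) hs"
      if "xs \<in> tuples B n" for xs
      using that hs(2) by (auto simp: restrict_op_def nary_def)
    \<comment> \<open>Operations are extensional, so agreement on \<open>tuples B n\<close> gives
      equality.\<close>
    have "app f = restrict (app f) (tuples B n)"
      using assms(3) by (simp add: operations_def n_def PiE_def extensional_restrict)
    also have "\<dots> = (\<lambda>xs\<in>tuples B n. app g (map (\<lambda>h. app h xs) (map (restrict_op B) hs)))"
      by (rule restrict_ext) (simp only: main args)
    finally show ?thesis unfolding superpose_def prod_eq_iff fst_conv snd_conv n_def by blast
  qed
  ultimately show ?thesis
    unfolding minor_le_def n_def[symmetric] by blast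
qed

theorem corollary3p2:
  fixes A :: "'a set" and r :: nat and \<rho> :: "'a list set"
  assumes "finite A"
    and "\<rho> \<subseteq> tuples A r"
    and "\<exists>B. B \<subseteq> A \<and> B \<noteq> {} \<and> Pol B r (\<rho> \<inter> tuples B r) \<notin> FF B"
  shows "Pol A r \<rho> \<notin> FF A"
proof
  assume FF: "Pol A r \<rho> \<in> FF A"
  obtain B where B: "B \<subseteq> A" "Pol B r (\<rho> \<inter> tuples B r) \<notin> FF B"
    using assms(3) by blast
  \<comment> \<open>For \<open>B = A\<close> the restricted relation is \<rho> itself, and
    \<open>B(2)\<close> would contradict \<open>FF\<close>.\<close>
  have "B \<noteq> A" using B(2) FF assms(2) by (auto simp: Int_absorb2)
  then obtain c where c: "c \<in> A" "c \<notin> B" using B(1) by blast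
  \<comment> \<open>Membership in \<open>FF B\<close> also demands a clone; with this settled,
    finiteness of the quotient alone contradicts \<open>B(2)\<close>.\<close>
  have cloneB: "clone B (Pol B r (\<rho> \<inter> tuples B r))" by (rule clone_Pol) simp
  have "finite (operations B // minor_equiv B (Pol B r (\<rho> \<inter> tuples B r)))"
  proof (rule finite_quotient_reflect)
    show "equiv (operations A) (minor_equiv A (Pol A r \<rho>))"
      using assms(2) by (intro equiv_minor_equiv clone_Pol)
    show "finite (operations A // minor_equiv A (Pol A r \<rho>))"
      using FF by (simp add: FF_def)
    show "extend_op A B c \<in> operations B \<rightarrow> operations A"
      by (rule funcsetI) (rule extend_op_operations[OF _ B(1) c(1)])
    \<comment> \<open>Each of the two inequalities between the extensions is reflected on its
      own.\<close>
    show "(f, g) \<in> minor_equiv B (Pol B r (\<rho> \<inter> tuples B r))"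
      if "f \<in> operations B" "g \<in> operations B"
        "(extend_op A B c f, extend_op A B c g) \<in> minor_equiv A (Pol A r \<rho>)" for f g
      using that minor_le_extend_opD[OF B(1) c(2)] by (auto simp: minor_equiv_def)
  qed (rule equiv_minor_equiv[OF cloneB])
  then show False using B(2) cloneB by (simp add: FF_def)
qed

end
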